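(* Let $f \colon X \rightarrow Y$ be a continuous mapping of a completely Baire space $X$ onto a hereditary weakly Preiss-Simon regular space $Y$ such that for every open subset $U$ of $X$ the image $f(U)$ is a resolvable set in $Y$. Then $Y$ is completely Baire.
   Context: Terminology follows Engelking's "General Topology"; in particular, regular spaces are assumed to be $T_1$. A topological space is a Baire space if the intersection of countably many dense open sets in it is dense. A space is completely Baire if every closed subspace of it is a Baire space. A set $E$ in a space $X$ is resolvable if it can be represented as $E = (F_1 \setminus F_2) \cup (F_3 \setminus F_4) \cup \ldots \cup (F_\xi \setminus F_{\xi+1}) \cup \ldots$, where $\langle F_\xi \rangle$ is a decreasing transfinite sequence of closed sets in $X$. Equivalently, $E$ is resolvable if, for every closed set $F \subset X$, the boundary of $F \cap E$ relative to $F$ is nowhere dense in $F$. A sequence $\langle U_n \colon n \in \omega \rangle$ of subsets of a space converges to a point $x$ if each neighborhood of $x$ contains all but finitely many of the sets $U_n$. A space $X$ is weakly Preiss-Simon at a point $x \in X$ if there is a sequence $\langle U_n \colon n \in \omega \rangle$ of nonempty open subsets of $X$ that converges to $x$. $wPS(X)$ denotes the set of points $x \in X$ at which $X$ is weakly Preiss-Simon. A space $X$ is hereditary weakly Preiss-Simon if for every nonempty closed set $F \subset X$ (with the subspace topology) the set $wPS(F)$ is dense in $F$. *)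

theory Defs
  imports "HOL-Analysis.Analysis"
begin

definition dense_in :: "'a topology \<Rightarrow> 'a set \<Rightarrow> bool" where
  "dense_in X D \<longleftrightarrow> D \<subseteq> topspace X \<and> X closure_of D = topspace X"

definition Baire_space :: "'a topology \<Rightarrow> bool" where
  "Baire_space X \<longleftrightarrow>
     (\<forall>G :: nat \<Rightarrow> 'a set.
        (\<forall>n. openin X (G n) \<and> dense_in X (G n)) \<longrightarrow> dense_in X (\<Inter>n. G n))"

definition completely_Baire_space :: "'a topology \<Rightarrow> bool" where
  "completely_Baire_space X \<longleftrightarrow> (\<forall>F. closedin X F \<longrightarrow> Baire_space (subtopology X F))"


definition next_index :: "'i rel \<Rightarrow> 'i \<Rightarrow> 'i \<Rightarrow> bool" where
  "next_index r i j \<longleftrightarrow> (i, j) \<in> r - Id \<and> (\<forall>k. (i, k) \<in> r - Id \<longrightarrow> (j, k) \<in> r)"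

text \<open>
  Positions of the form \<open>\<lambda> + 2n\<close>, with \<open>\<lambda>\<close> zero or a limit, in a well-order.
  If counting starts at 1 instead of 0, these are the positions
  \<open>1, 3, 5, \<dots>, \<omega>, \<omega> + 2, \<dots>\<close>.
\<close>

inductive even_index :: "'i rel \<Rightarrow> 'i \<Rightarrow> bool" for r where
  zero_or_limit: "i \<in> Field r \<Longrightarrow> (\<And>j. \<not> next_index r j i) \<Longrightarrow> even_index r i"
| plus_two: "even_index r i \<Longrightarrow> next_index r i j \<Longrightarrow> next_index r j k \<Longrightarrow> even_index r k"

text \<open>
  The set \<open>E\<close> is \<open>(F\<^sub>1 - F\<^sub>2) \<union> (F\<^sub>3 - F\<^sub>4) \<union> \<dots> \<union> (F\<^sub>\<xi> - F\<^bsub>\<xi>+1\<^esub>) \<union> \<dots>\<close>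
  for a decreasing transfinite sequence \<open>F\<close> of closed sets, whose indices are the elements of the
  well-order \<open>r\<close>. An even index that is last in \<open>r\<close> contributes nothing; to include
  the whole of the last closed set, append the empty set to the sequence.
\<close>

definition resolution_of ::
    "'a topology \<Rightarrow> 'a set \<Rightarrow> 'i rel \<Rightarrow> ('i \<Rightarrow> 'a set) \<Rightarrow> bool" where
  "resolution_of X E r F \<longleftrightarrow>
     Well_order r \<and>
     (\<forall>i \<in> Field r. closedin X (F i)) \<and>
     (\<forall>i j. (i, j) \<in> r \<longrightarrow> F j \<subseteq> F i) \<and>
     E = \<Union> {F i - F j | i j. even_index r i \<and> next_index r i j}"

text \<open>
  A definition cannot quantify over index types. The type \<^typ>\<open>'a \<times> bool\<close> is large
  enough: only nonempty differences matter, and a point of such a difference together with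
  a Boolean can name its two indices. Lemma \<open>resolvable_inI\<close> proves this.
\<close>

definition resolvable_in :: "'a topology \<Rightarrow> 'a set \<Rightarrow> bool" where
  "resolvable_in X E \<longleftrightarrow>
     (\<exists>(r :: ('a \<times> bool) rel) F. resolution_of X E r F)"


definition sets_converge_to :: "'a topology \<Rightarrow> (nat \<Rightarrow> 'a set) \<Rightarrow> 'a \<Rightarrow> bool" where
  "sets_converge_to X U x \<longleftrightarrow>
     (\<forall>V. openin X V \<and> x \<in> V \<longrightarrow> (\<forall>\<^sub>F n in sequentially. U n \<subseteq> V))"

definition weakly_Preiss_Simon_at :: "'a topology \<Rightarrow> 'a \<Rightarrow> bool" where
  "weakly_Preiss_Simon_at X x \<longleftrightarrow>
     x \<in> topspace X \<and>
     (\<exists>U :: nat \<Rightarrow> 'a set. (\<forall>n. openin X (U n) \<and> U n \<noteq> {}) \<and> sets_converge_to X U x)"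

definition wPS :: "'a topology \<Rightarrow> 'a set" where
  "wPS X = {x. weakly_Preiss_Simon_at X x}"

definition hereditary_weakly_Preiss_Simon :: "'a topology \<Rightarrow> bool" where
  "hereditary_weakly_Preiss_Simon X \<longleftrightarrow>
     (\<forall>F. closedin X F \<and> F \<noteq> {} \<longrightarrow>
        dense_in (subtopology X F) (wPS (subtopology X F)))"


lemma next_index_unique:
  assumes "Well_order r" "next_index r i j" "next_index r i k"
  shows "j = k"
  using assms wo_rel.ANTISYM[of r] unfolding wo_rel_def next_index_def antisym_def by blast

lemma even_index_Field: "even_index r i \<Longrightarrow> i \<in> Field r"
  by (erule even_index.cases) (auto simp: next_index_def Field_def)

lemma resolvable_inI:
  fixes r :: "'i rel"
  assumes "resolution_of X E r F"
  shows "resolvable_in X E"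
proof -
  have wo: "Well_order r"
    and clo: "\<And>i. i \<in> Field r \<Longrightarrow> closedin X (F i)"
    and dec: "\<And>i j. (i, j) \<in> r \<Longrightarrow> F j \<subseteq> F i"
    and E: "E = \<Union> {F i - F j | i j. even_index r i \<and> next_index r i j}"
    using assms unfolding resolution_of_def by auto
  interpret wo_rel r using wo by unfold_locales
  define s where "s i = (SOME j. next_index r i j)" for i
  have s: "s i = j" if "next_index r i j" for i j
    unfolding s_def using that next_index_unique[OF wo] by (metis someI)
  define R where "R p i \<longleftrightarrow> even_index r i \<and> next_index r i (s i) \<and> p \<in> F i - F (s i)" for p i
  have R_unique: "i = j" if "R p i" "R p j" for p i j
  proof -
    have "i \<in> Field r" "j \<in> Field r" using that even_index_Field unfolding R_def by auto
    moreover have False if "(i, j) \<in> r" "i \<noteq> j" "R p i" "R p j" for i j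
    proof -
      have "(s i, j) \<in> r" using that unfolding R_def next_index_def by auto
      then show False using dec that unfolding R_def by blast
    qed
    ultimately show ?thesis using TOTALS that by metis
  qed
  define B where "B = {i. \<exists>p. R p i}"
  define x where "x i = (SOME p. R p i)" for i
  have x: "R (x i) i" if "i \<in> B" for i
    using that unfolding B_def x_def by (auto intro: someI)
  define P where "P = x ` B"
  define b where "b p = (THE i. i \<in> B \<and> x i = p)" for p
  have bx: "b (x i) = i" if "i \<in> B" for i
    unfolding b_def using that x R_unique by (intro the_equality) (auto, metis)
  have bB: "b p \<in> B" if "p \<in> P" for p using that bx unfolding P_def by auto
  have b_inj: "p = q" if "p \<in> P" "q \<in> P" "b p = b q" for p q
    using that bx unfolding P_def by auto
  have bR: "even_index r (b p)" "next_index r (b p) (s (b p))" if "p \<in> P" for p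
    using x[OF bB[OF that]] unfolding R_def by auto
  have bF: "b p \<in> Field r" "s (b p) \<in> Field r" if "p \<in> P" for p
    using bR[OF that] even_index_Field unfolding next_index_def Field_def by auto
  define S :: "('a \<times> bool) rel" where
    "S = {((p, u), (q, v)). p \<in> P \<and> q \<in> P \<and>
            (p \<noteq> q \<and> (b p, b q) \<in> r \<or> p = q \<and> (u \<longrightarrow> v))}"
  define G where "G = (\<lambda>(p, u). if u then F (s (b p)) else F (b p))"
  have FS: "Field S = P \<times> UNIV"
    unfolding S_def Field_def by auto
  have S_iff: "((p, u), (q, v)) \<in> S \<longleftrightarrow>
      p \<in> P \<and> q \<in> P \<and> (p \<noteq> q \<and> (b p, b q) \<in> r \<or> p = q \<and> (u \<longrightarrow> v))" for p u q v
    unfolding S_def by auto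
  have wfS: "wf (S - Id)"
  proof (rule wf_subset)
    show "wf (inv_image ((r - Id) <*lex*> {(u, v). \<not> u \<and> v}) (\<lambda>(p, u). (b p, u :: bool)))"
    proof (intro wf_inv_image wf_lex_prod WF)
      show "wf {(u, v). \<not> u \<and> v}"
        by (rule wf_subset[OF wf_measure[of "\<lambda>u. if u then 1 else 0"]]) auto
    qed
    show "S - Id \<subseteq> inv_image ((r - Id) <*lex*> {(u, v). \<not> u \<and> v}) (\<lambda>(p, u). (b p, u))"
      unfolding S_def using b_inj by auto
  qed
  have woS: "Well_order S"
    unfolding well_order_on_def linear_order_on_def partial_order_on_def preorder_on_def
  proof (intro conjI wfS)
    show "S \<subseteq> Field S \<times> Field S" by (auto simp: Field_def)
    show "Refl S" unfolding refl_on_def FS by (auto simp: S_iff)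
    show "trans S"
    proof (rule transI, clarify)
      fix p u q v w z
      assume "((p, u), (q, v)) \<in> S" "((q, v), (w, z)) \<in> S"
      then show "((p, u), (w, z)) \<in> S"
        using transD[OF TRANS, of "b p" "b q" "b w"] antisymD[OF ANTISYM, of "b p" "b q"] b_inj[of p q]
        by (cases "p = q"; cases "q = w"; cases "p = w") (simp_all add: S_iff)
    qed
    show "antisym S"
    proof (rule antisymI, clarify)
      fix p u q v
      assume "((p, u), (q, v)) \<in> S" "((q, v), (p, u)) \<in> S"
      then show "p = q \<and> u = v"
        using antisymD[OF ANTISYM, of "b p" "b q"] b_inj[of p q]
        by (cases "p = q") (auto simp: S_iff)
    qed
    show "Total S"
      unfolding total_on_def FS using TOTALS bF by (auto simp: S_iff)
  qed
  have nextS: "next_index S (p, False) (p, True)" if "p \<in> P" for p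
    using that unfolding next_index_def by (auto simp: S_iff)
  have next_even: "u \<and> q \<noteq> p" if "next_index S (q, u) (p, False)" for p q u
  proof -
    have *: "((q, u), (p, False)) \<in> S" "(q, u) \<noteq> (p, False)" using that
      unfolding next_index_def by auto
    then have "q \<noteq> p" by (auto simp: S_iff)
    moreover have u
    proof (rule ccontr)
      assume "\<not> u"
      then have "((q, True), (p, False)) \<in> S" "((p, False), (q, True)) \<in> S"
        using * that \<open>q \<noteq> p\<close> unfolding next_index_def by (auto simp: S_iff)
      then show False
        using antisymD[OF ANTISYM, of "b p" "b q"] b_inj[of p q] \<open>q \<noteq> p\<close> by (simp add: S_iff)
    qed
    ultimately show ?thesis by simp
  qed
  have even1: "p \<in> P \<longrightarrow> \<not> u \<longrightarrow> even_index S (p, u)" for p u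
  proof (induction "(p, u)" arbitrary: p u rule: wf_induct_rule[OF wfS])
    case (1 p u)
    show ?case
    proof (intro impI)
      assume pu: "p \<in> P" "\<not> u"
      show "even_index S (p, u)"
      proof (cases "\<exists>j. next_index S j (p, u)")
        case False
        then show ?thesis using pu by (intro zero_or_limit) (auto simp: FS)
      next
        case True
        then obtain q v where qv: "next_index S (q, v) (p, u)" by auto
        then have v: v "q \<noteq> p" using next_even pu by auto
        have q: "q \<in> P" "(b q, b p) \<in> r" using qv v unfolding next_index_def by (auto simp: S_iff)
        then have "((q, False), (p, u)) \<in> S - Id" using v pu by (auto simp: S_iff)
        then have "even_index S (q, False)" using 1 q by blast
        then show ?thesis using nextS[OF q(1)] qv v plus_two by (metis (full_types))
      qed
    qed
  qed
  have even2: "\<not> snd i" if "even_index S i" for i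
    using that
  proof induction
    case (zero_or_limit i)
    then show ?case using nextS unfolding FS by (metis (full_types) mem_Times_iff prod.collapse)
  next
    case (plus_two i j k)
    obtain p where i: "i = (p, False)" and p: "p \<in> P"
      using plus_two even_index_Field[of S i] by (cases i) (auto simp: FS)
    have j: "j = (p, True)" using next_index_unique[OF woS plus_two(2)] nextS[OF p] i by auto
    obtain q v where k: "k = (q, v)" by fastforce
    have "((p, True), (q, v)) \<in> S - Id" using plus_two j k unfolding next_index_def by auto
    then have pq: "q \<noteq> p" "q \<in> P" "((p, True), (q, False)) \<in> S - Id" by (auto simp: S_iff)
    then have "((q, v), (q, False)) \<in> S" using plus_two j k unfolding next_index_def by auto
    then show ?case using k by (auto simp: S_iff)
  qed
  have "resolution_of X E S G"
    unfolding resolution_of_def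
  proof (intro conjI woS ballI allI impI)
    show "closedin X (G i)" if "i \<in> Field S" for i
      using that clo bF unfolding FS G_def by auto
  next
    fix i j assume ij: "(i, j) \<in> S"
    obtain p u q v where eq: "i = (p, u)" "j = (q, v)" by fastforce
    have P: "p \<in> P" "q \<in> P" using ij by (auto simp: eq S_iff)
    have "F (s (b p)) \<subseteq> F (b p)" "F (s (b q)) \<subseteq> F (b q)"
      using dec bR(2) P unfolding next_index_def by auto
    moreover have "F (b q) \<subseteq> F (s (b p))" if "p \<noteq> q"
    proof -
      have "(b p, b q) \<in> r - Id" using that ij b_inj by (auto simp: eq S_iff)
      then show ?thesis using bR(2)[OF P(1)] dec unfolding next_index_def by auto
    qed
    ultimately show "G j \<subseteq> G i"
      using ij unfolding G_def eq S_iff by (cases "p = q") (auto split: if_splits)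
  next
    have *: "{(i, j). even_index S i \<and> next_index S i j} = {((p, False), (p, True)) | p. p \<in> P}"
    proof (intro equalityI subsetI)
      fix z assume "z \<in> {(i, j). even_index S i \<and> next_index S i j}"
      then obtain p u j where z: "z = ((p, u), j)" "even_index S (p, u)" "next_index S (p, u) j"
        by (cases z) auto
      then have "\<not> u" "p \<in> P" using even2[of "(p, u)"] even_index_Field[of S "(p, u)"]
        by (auto simp: FS)
      moreover from this have "j = (p, True)"
        using next_index_unique[OF woS z(3)] nextS by auto
      ultimately show "z \<in> {((p, False), (p, True)) | p. p \<in> P}" using z by auto
    qed (use even1 nextS in auto)
    have "\<Union> {G i - G j | i j. even_index S i \<and> next_index S i j}
        = \<Union> ((\<lambda>(i, j). G i - G j) ` {(i, j). even_index S i \<and> next_index S i j})"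
      by (rule arg_cong[where f = Union], unfold image_def, fast)
    also have "\<dots> = \<Union> ((\<lambda>(i, j). G i - G j) ` (\<lambda>p. ((p, False), (p, True))) ` P)"
      unfolding * by (rule arg_cong[where f = "\<lambda>A. \<Union> ((\<lambda>(i, j). G i - G j) ` A)"]) blast
    also have "\<dots> = (\<Union>p \<in> P. F (b p) - F (s (b p)))"
      unfolding image_image by (simp add: G_def)
    also have "\<dots> = (\<Union>i \<in> B. F i - F (s i))"
      unfolding P_def by (auto simp: bx)
    also have "\<dots> = E"
    proof (intro equalityI subsetI)
      fix y assume "y \<in> (\<Union>i \<in> B. F i - F (s i))"
      then show "y \<in> E" unfolding E B_def R_def by blast
    next
      fix y assume "y \<in> E"
      then obtain i j where "even_index r i" "next_index r i j" "y \<in> F i - F j"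
        unfolding E by auto
      then have "R y i" unfolding R_def using s by auto
      then show "y \<in> (\<Union>i \<in> B. F i - F (s i))" unfolding B_def R_def by auto
    qed
    finally show "E = \<Union> {G i - G j | i j. even_index S i \<and> next_index S i j}" by simp
  qed
  then show ?thesis unfolding resolvable_in_def by blast
qed

end

theory Submission
  imports Defs
begin

text \<open>
  The proof looks for a countable closed subspace of \<open>Y\<close> on which the map \<open>f\<close> would
  have to make too many sets resolvable.

  Suppose that a closed subspace \<open>Z\<close> of \<open>Y\<close> is not Baire. Then some nonempty open
  set of \<open>Z\<close> misses the intersection of countably many dense open sets \<open>G\<^sub>n\<close> of
  \<open>Z\<close>. As in Hurewicz's theorem on closed copies of the rationals, a tree of points
  \<open>x\<^sub>s\<close> with neighbourhoods \<open>V\<^sub>s\<close> is grown, indexed by finite sequences of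
  naturals: the neighbourhoods of the children of \<open>x\<^sub>s\<close> converge to \<open>x\<^sub>s\<close>,
  which is where the weak Preiss-Simon property enters, and their closures lie in \<open>V\<^sub>s\<close> and
  in \<open>G\<^sub>n\<close>, where \<open>n\<close> is the length of \<open>s\<close>. The set \<open>D\<close> of
  all \<open>x\<^sub>s\<close> is closed, because a point of its closure outside \<open>D\<close> would
  descend through all levels of the tree and thus lie in every \<open>G\<^sub>n\<close> and in the open set
  that misses their intersection. Since each
  \<open>x\<^sub>s\<close> is a limit of its children, the even levels and the odd levels of the tree are
  two disjoint dense subsets \<open>A\<close> and \<open>B\<close> of \<open>D\<close>
  (lemma \<open>non_Baire_closed_countable_two_dense\<close>).

  The preimage of \<open>D\<close> is closed in \<open>X\<close>, hence Baire, and it is the union of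
  countably many closed fibres. So the interiors of these fibres, taken in the preimage of
  \<open>D\<close>, have a dense union. Let \<open>E\<close> be the set of points of \<open>D\<close> whose
  fibre has nonempty interior. It is dense in \<open>D\<close>, and each subset of \<open>E\<close> is the
  image of a union of interiors of fibres, hence resolvable in \<open>D\<close>. A resolvable set that is
  dense in a nonempty open set contains a nonempty open part of it. Applied to \<open>E\<close> this gives
  a nonempty open \<open>V\<close> contained in \<open>E\<close>, and applied to the intersection of
  \<open>A\<close> and \<open>E\<close>, which is dense in \<open>V\<close>, it gives a nonempty open subset of
  \<open>A\<close>. This is impossible because \<open>B\<close> is dense and disjoint from \<open>A\<close>
  (lemma \<open>resolvable_images_countable_no_disjoint_dense\<close>).
\<close>


section \<open>Dense sets and resolvable sets\<close>

lemma dense_in_iff_meets_openin: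
  "dense_in X D \<longleftrightarrow> D \<subseteq> topspace X \<and> (\<forall>U. openin X U \<and> U \<noteq> {} \<longrightarrow> U \<inter> D \<noteq> {})"
  unfolding dense_in_def dense_intersects_open by (auto simp: Int_commute)

lemma dense_in_meets_openin:
  "dense_in X D \<Longrightarrow> openin X U \<Longrightarrow> U \<noteq> {} \<Longrightarrow> U \<inter> D \<noteq> {}"
  unfolding dense_in_iff_meets_openin by simp

lemma resolvable_in_subtopology:
  fixes Y :: "'b topology"
  assumes "resolvable_in Y E"
  shows "resolvable_in (subtopology Y D) (E \<inter> D)"
proof -
  obtain r :: "('b \<times> bool) rel" and F where r: "resolution_of Y E r F"
    using assms unfolding resolvable_in_def by blast
  have "resolution_of (subtopology Y D) (E \<inter> D) r (\<lambda>i. F i \<inter> D)"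
    unfolding resolution_of_def
  proof (intro conjI ballI allI impI)
    show "Well_order r" using r unfolding resolution_of_def by blast
    show "closedin (subtopology Y D) (F i \<inter> D)" if "i \<in> Field r" for i
      using r that unfolding resolution_of_def closedin_subtopology by blast
    show "F j \<inter> D \<subseteq> F i \<inter> D" if "(i, j) \<in> r" for i j
      using r that unfolding resolution_of_def by blast
    have "E = \<Union> {F i - F j | i j. even_index r i \<and> next_index r i j}"
      using r unfolding resolution_of_def by blast
    then show "E \<inter> D = \<Union> {F i \<inter> D - F j \<inter> D | i j. even_index r i \<and> next_index r i j}"
      by blast
  qed
  then show ?thesis unfolding resolvable_in_def by blast
qed

text \<open>
  Look at the first closed set \<open>F j\<close> of the transfinite sequence that does not contain all of
  \<open>V\<close>. On the open set \<open>V - F j\<close> every earlier member of the sequence is full and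
  every later one is empty, so only one difference, of the form \<open>F i - F j\<close>, can meet
  \<open>V - F j\<close>, and that difference contains it.
\<close>

lemma resolvable_in_contains_open:
  fixes Y :: "'b topology"
  assumes "resolvable_in Y E" and "openin Y V" and "V \<noteq> {}"
    and meets: "\<And>U. openin Y U \<Longrightarrow> U \<noteq> {} \<Longrightarrow> U \<subseteq> V \<Longrightarrow> U \<inter> E \<noteq> {}"
  obtains U where "openin Y U" "U \<noteq> {}" "U \<subseteq> V" "U \<subseteq> E"
proof -
  obtain r :: "('b \<times> bool) rel" and F where r: "resolution_of Y E r F"
    using assms(1) unfolding resolvable_in_def by blast
  have wo: "Well_order r"
    and clo: "\<And>i. i \<in> Field r \<Longrightarrow> closedin Y (F i)"
    and dec: "\<And>i j. (i, j) \<in> r \<Longrightarrow> F j \<subseteq> F i"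
    and E: "E = \<Union> {F i - F j | i j. even_index r i \<and> next_index r i j}"
    using r unfolding resolution_of_def by blast+
  interpret wo_rel r using wo by unfold_locales
  define J where "J = {j \<in> Field r. \<not> V \<subseteq> F j}"
  have J_next: "k \<in> J" if "next_index r i k" "p \<in> V" "p \<notin> F k" for i k p
    using that unfolding J_def next_index_def Field_def by auto
  have "J \<noteq> {}"
    using meets[OF assms(2,3)] J_next unfolding E by blast
  define j where "j = minim J"
  have j: "j \<in> J" and j_least: "\<And>k. k \<in> J \<Longrightarrow> (j, k) \<in> r"
    using minim_in[of J] minim_least[of J] \<open>J \<noteq> {}\<close> unfolding j_def J_def by auto
  define U where "U = V - F j"
  have "closedin Y (F j)" using j clo unfolding J_def by blast
  then have U: "openin Y U" "U \<noteq> {}" "U \<subseteq> V"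
    using j openin_diff[OF assms(2)] unfolding U_def J_def by auto
  then obtain p i k where p: "p \<in> U" "p \<in> F i" "p \<notin> F k" "even_index r i" "next_index r i k"
    using meets[OF U] unfolding E by blast
  have "k \<in> J" using J_next p U by blast
  then have "(j, k) \<in> r" by (rule j_least)
  have "(j, i) \<notin> r" using p dec unfolding U_def by blast
  moreover have "i \<in> Field r" "j \<in> Field r"
    using p j unfolding J_def next_index_def Field_def by auto
  ultimately have ij: "(i, j) \<in> r - Id"
    using TOTALS REFL unfolding refl_on_def by blast
  then have "(k, j) \<in> r" using p unfolding next_index_def by blast
  then have "k = j" using \<open>(j, k) \<in> r\<close> ANTISYM unfolding antisym_def by blast
  have "i \<notin> J"
    using ij j_least ANTISYM unfolding antisym_def by blast
  then have "V \<subseteq> F i" using \<open>i \<in> Field r\<close> unfolding J_def by blast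
  then have "U \<subseteq> E" using p \<open>k = j\<close> unfolding U_def E by blast
  then show thesis using that U by blast
qed

section \<open>Resolvable images in a countable space\<close>

text \<open>
  The complements of the frontiers of the closed fibres are countably many dense open sets, and a
  point outside all these frontiers is interior to its own fibre.
\<close>

lemma Baire_space_dense_fibre_interiors:
  assumes "Baire_space X" and "continuous_map X Y f" and "t1_space Y" and "countable (topspace Y)"
  shows "dense_in X (\<Union>y\<in>topspace Y. X interior_of {x \<in> topspace X. f x = y})"
proof (cases "topspace Y = {}")
  case True
  then have "topspace X = {}" using assms(2) unfolding continuous_map_def by blast
  then show ?thesis unfolding dense_in_def using True by simp
next
  case False
  define e where "e = from_nat_into (topspace Y)"
  have e: "range e = topspace Y" unfolding e_def using False assms(4) by (rule range_from_nat_into)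
  define C where "C n = {x \<in> topspace X. f x = e n}" for n
  define G where "G n = topspace X - X frontier_of (C n)" for n
  have clo: "closedin X (C n)" for n
  proof -
    have "closedin Y {e n}" using closedin_t1_singleton[OF assms(3)] e by (metis rangeI)
    then have "closedin X {x \<in> topspace X. f x \<in> {e n}}"
      by (rule closedin_continuous_map_preimage[OF assms(2)])
    then show ?thesis unfolding C_def by simp
  qed
  have "openin X (G n)" for n
    unfolding G_def by (simp add: openin_diff closedin_frontier_of)
  moreover have "dense_in X (G n)" for n
  proof -
    have "X interior_of (X frontier_of (C n)) = {}"
      using interior_of_subset[of X "X frontier_of (C n)"] frontier_of_subset_closedin[OF clo[of n]]
        interior_of_maximal[of "X interior_of (X frontier_of (C n))" "C n" X]
      unfolding frontier_of_def by fastforce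
    then show ?thesis
      unfolding dense_in_def G_def closure_of_complement by simp
  qed
  ultimately have "dense_in X (\<Inter>n. G n)" using assms(1) unfolding Baire_space_def by blast
  moreover have "(\<Inter>n. G n) \<subseteq> (\<Union>y\<in>topspace Y. X interior_of {x \<in> topspace X. f x = y})"
  proof
    fix x assume x: "x \<in> (\<Inter>n. G n)"
    then have "x \<in> topspace X" unfolding G_def by blast
    then have "f x \<in> range e" using assms(2) e unfolding continuous_map_def by auto
    then obtain n where n: "f x = e n" by blast
    have "x \<in> C n" using n \<open>x \<in> topspace X\<close> unfolding C_def by simp
    moreover have "x \<notin> X frontier_of (C n)" using x unfolding G_def by blast
    ultimately have "x \<in> X interior_of (C n)"
      unfolding frontier_of_def using closure_of_subset[of "C n" X] C_def by blast
    then show "x \<in> (\<Union>y\<in>topspace Y. X interior_of {x \<in> topspace X. f x = y})"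
      using e unfolding C_def by blast
  qed
  ultimately show ?thesis
    unfolding dense_in_def
    by (metis (no_types, lifting) UN_least closure_of_mono closure_of_subset_topspace
        interior_of_subset_topspace subset_antisym)
qed

text \<open>
  An arbitrary set of points whose fibres have nonempty interior is the image of an open set. Hence
  all such sets are resolvable, which is too much when the space splits into two dense parts.
\<close>

lemma resolvable_images_countable_no_disjoint_dense:
  assumes "Baire_space X" and "continuous_map X Y f" and "f ` topspace X = topspace Y"
    and "t1_space Y" and "countable (topspace Y)"
    and res: "\<And>U. openin X U \<Longrightarrow> resolvable_in Y (f ` U)"
    and "dense_in Y A" and "dense_in Y B" and "A \<inter> B = {}"
  shows "topspace Y = {}"
proof (rule ccontr)
  assume "topspace Y \<noteq> {}"
  define I where "I y = X interior_of {x \<in> topspace X. f x = y}" for y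
  define W where "W S = (\<Union>y\<in>S. I y)" for S
  have I: "f x = y" if "x \<in> I y" for x y
    using that interior_of_subset[of X "{x \<in> topspace X. f x = y}"] unfolding I_def by auto
  have W_open: "openin X (W S)" for S unfolding W_def I_def by auto
  have W_dense: "dense_in X (W (topspace Y))"
    unfolding W_def I_def by (rule Baire_space_dense_fibre_interiors[OF assms(1,2,4,5)])
  \<comment> \<open>the points of \<open>Y\<close> whose fibre has nonempty interior\<close>
  define E where "E = f ` W (topspace Y)"
  have meets: "U \<inter> E \<noteq> {}" if U: "openin Y U" "U \<noteq> {}" for U
  proof -
    have "openin X {x \<in> topspace X. f x \<in> U}"
      using assms(2) U by (simp add: openin_continuous_map_preimage)
    moreover have "{x \<in> topspace X. f x \<in> U} \<noteq> {}"
    proof -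
      obtain y where "y \<in> U" using U(2) by blast
      then have "y \<in> f ` topspace X" using assms(3) openin_subset[OF U(1)] by auto
      then show ?thesis using \<open>y \<in> U\<close> by blast
    qed
    ultimately show ?thesis
      using dense_in_meets_openin[OF W_dense] unfolding E_def by blast
  qed
  obtain V where V: "openin Y V" "V \<noteq> {}" "V \<subseteq> E"
    using resolvable_in_contains_open[of Y E "topspace Y"] meets res[OF W_open] \<open>topspace Y \<noteq> {}\<close>
    unfolding E_def by (metis openin_topspace)
  have AE: "f ` W (A \<inter> E) = A \<inter> E"
  proof
    show "f ` W (A \<inter> E) \<subseteq> A \<inter> E" using I unfolding W_def by auto
    show "A \<inter> E \<subseteq> f ` W (A \<inter> E)"
      using I unfolding E_def W_def by fastforce
  qed
  have "resolvable_in Y (A \<inter> E)" using res[OF W_open] AE by metis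
  moreover have "U \<inter> (A \<inter> E) \<noteq> {}" if "openin Y U" "U \<noteq> {}" "U \<subseteq> V" for U
    using that V(3) dense_in_meets_openin[OF assms(7), of U] by blast
  ultimately obtain U where "openin Y U" "U \<noteq> {}" "U \<subseteq> A \<inter> E"
    using resolvable_in_contains_open[of Y "A \<inter> E" V] V by metis
  then show False using dense_in_meets_openin[OF assms(8)] assms(9) by blast
qed

section \<open>A countable closed subspace with two disjoint dense subsets\<close>

text \<open>
  This is one branching step of the tree. Regularity shrinks the members of a sequence of open sets
  converging to \<open>x\<close> so that their closures avoid \<open>x\<close>. Then each shrunken set is
  disjoint from almost all of the others, since these converge to \<open>x\<close>, and a sparse
  subsequence is pairwise disjoint.
\<close>

lemma wPS_disjoint_open_sequence:
  assumes "regular_space Z" and "t1_space Z" and "dense_in Z (wPS Z)"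
    and "openin Z V" and "openin Z G" and "dense_in Z G"
    and "x \<in> wPS Z" and "x \<in> V" and no_isolated: "\<And>z. z \<in> V \<Longrightarrow> \<not> openin Z {z}"
  obtains a W where
    "\<And>k :: nat. a k \<in> wPS Z \<inter> W k \<and> openin Z (W k) \<and> Z closure_of W k \<subseteq> V \<inter> G - {x}"
    "\<And>k l. k \<noteq> l \<Longrightarrow> W k \<inter> W l = {}"
    "sets_converge_to Z W x"
proof -
  obtain U :: "nat \<Rightarrow> 'a set" where U: "\<And>n. openin Z (U n) \<and> U n \<noteq> {}" "sets_converge_to Z U x"
    using assms(7) unfolding wPS_def weakly_Preiss_Simon_at_def by blast
  have xZ: "x \<in> topspace Z" using assms(4,8) openin_subset by blast
  have "\<forall>\<^sub>F n in sequentially. U n \<subseteq> V"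
    using U(2) assms(4,8) unfolding sets_converge_to_def by blast
  then obtain m where m: "\<And>n. n \<ge> m \<Longrightarrow> U n \<subseteq> V"
    unfolding eventually_sequentially by blast
  have "\<exists>p. fst p \<in> wPS Z \<inter> snd p \<and> openin Z (snd p) \<and>
      Z closure_of snd p \<subseteq> V \<inter> G - {x} \<and> snd p \<subseteq> U (m + n)" for n
  proof -
    define O' where "O' = U (m + n) \<inter> G - {x}"
    have ne: "U (m + n) \<inter> G \<noteq> {}"
      using dense_in_meets_openin[OF assms(6)] U(1) by metis
    have op: "openin Z (U (m + n) \<inter> G)" using U(1) assms(5) by (simp add: openin_Int)
    have "openin Z O'"
      unfolding O'_def using op assms(2) xZ closedin_t1_singleton openin_diff by metis
    moreover have "O' \<noteq> {}"
    proof
      assume "O' = {}"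
      then have "U (m + n) \<inter> G = {x}" using ne unfolding O'_def by blast
      then show False using no_isolated[OF assms(8)] op by simp
    qed
    then obtain z where "z \<in> O'" by blast
    ultimately obtain P C where P: "openin Z P" "closedin Z C" "z \<in> P" "P \<subseteq> C" "C \<subseteq> O'"
      using assms(1) neighbourhood_base_of_closedin unfolding neighbourhood_base_of by metis
    then obtain a where "a \<in> wPS Z \<inter> P"
      using dense_in_meets_openin[OF assms(3), of P] by blast
    moreover have "Z closure_of P \<subseteq> C" using P closure_of_minimal by blast
    moreover have "O' \<subseteq> V \<inter> G - {x}" "O' \<subseteq> U (m + n)"
      using m[of "m + n"] unfolding O'_def by auto
    ultimately show ?thesis using P by (intro exI[of _ "(a, P)"]) auto
  qed
  then obtain p where p: "\<And>n. fst (p n) \<in> wPS Z \<inter> snd (p n) \<and> openin Z (snd (p n)) \<and>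
      Z closure_of snd (p n) \<subseteq> V \<inter> G - {x} \<and> snd (p n) \<subseteq> U (m + n)" by metis
  have conv: "sets_converge_to Z (\<lambda>n. snd (p n)) x"
    unfolding sets_converge_to_def
  proof (intro allI impI)
    fix O' assume "openin Z O' \<and> x \<in> O'"
    then obtain K where "\<And>n. n \<ge> K \<Longrightarrow> U n \<subseteq> O'"
      using U(2) unfolding sets_converge_to_def eventually_sequentially by blast
    then have "snd (p n) \<subseteq> O'" if "n \<ge> K" for n
      using p[of n] that by (meson order_trans trans_le_add2)
    then show "\<forall>\<^sub>F n in sequentially. snd (p n) \<subseteq> O'"
      unfolding eventually_sequentially by blast
  qed
  have "\<exists>M. \<forall>i\<ge>M. snd (p i) \<inter> snd (p j) = {}" for j
  proof -
    have "openin Z (topspace Z - Z closure_of snd (p j))" by (simp add: openin_diff)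
    moreover have "x \<in> topspace Z - Z closure_of snd (p j)" using p[of j] xZ by blast
    ultimately obtain M where
      M: "\<And>i. i \<ge> M \<Longrightarrow> snd (p i) \<subseteq> topspace Z - Z closure_of snd (p j)"
      using conv unfolding sets_converge_to_def eventually_sequentially by blast
    moreover have "snd (p j) \<subseteq> Z closure_of snd (p j)"
      using p[of j] closure_of_subset[of "snd (p j)" Z] openin_subset[of Z "snd (p j)"] by blast
    ultimately show ?thesis by blast
  qed
  then obtain M where M: "\<And>j i. i \<ge> M j \<Longrightarrow> snd (p i) \<inter> snd (p j) = {}" by metis
  \<comment> \<open>The index \<open>h (Suc k)\<close> is past the bound \<open>M (h k)\<close>, and so are all later ones.\<close>
  define h where "h = rec_nat 0 (\<lambda>_ j. max (Suc j) (M j))"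
  have h_Suc: "h (Suc k) = max (Suc (h k)) (M (h k))" for k unfolding h_def by simp
  have h_mono: "strict_mono h" by (rule strict_monoI_Suc) (simp add: h_Suc)
  have disj: "snd (p (h l)) \<inter> snd (p (h k)) = {}" if "k < l" for k l
  proof -
    have "M (h k) \<le> h (Suc k)" by (simp add: h_Suc)
    also have "\<dots> \<le> h l" using that h_mono by (simp add: strict_mono_less_eq)
    finally show ?thesis by (rule M)
  qed
  show thesis
  proof (rule that[of "\<lambda>k. fst (p (h k))" "\<lambda>k. snd (p (h k))"])
    show "snd (p (h k)) \<inter> snd (p (h l)) = {}" if "k \<noteq> l" for k l
      using that disj by (metis Int_commute linorder_neqE_nat)
    show "sets_converge_to Z (\<lambda>k. snd (p (h k))) x"
      using conv filterlim_subseq[OF h_mono]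
      unfolding sets_converge_to_def filterlim_iff by blast
  qed (use p in blast)
qed

text \<open>
  The tree of the introduction. Its nodes are lists in which the most recent branching comes
  first, so the children of \<open>s\<close> are the lists \<open>k # s\<close>, and the descendants of
  \<open>s\<close> are the lists \<open>t @ s\<close>.
\<close>

lemma non_Baire_closed_countable_two_dense:
  assumes "regular_space Z" and "t1_space Z" and "dense_in Z (wPS Z)" and "\<not> Baire_space Z"
  obtains A B where "closedin Z (A \<union> B)" "countable (A \<union> B)" "A \<noteq> {}" "A \<inter> B = {}"
    "dense_in (subtopology Z (A \<union> B)) A" "dense_in (subtopology Z (A \<union> B)) B"
proof -
  have Haus: "Hausdorff_space Z"
    using assms(1,2) regular_t1_imp_Hausdorff_space by blast
  obtain G :: "nat \<Rightarrow> 'a set" where G: "\<And>n. openin Z (G n)" "\<And>n. dense_in Z (G n)"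
    and "\<not> dense_in Z (\<Inter>n. G n)"
    using assms(4) unfolding Baire_space_def by blast
  moreover have "(\<Inter>n. G n) \<subseteq> topspace Z" using G(1) openin_subset by blast
  ultimately obtain V0 where V0: "openin Z V0" "V0 \<noteq> {}" "V0 \<inter> (\<Inter>n. G n) = {}"
    unfolding dense_in_iff_meets_openin by blast
  \<comment> \<open>An isolated point would belong to every dense set.\<close>
  have no_isolated: "\<not> openin Z {z}" if "z \<in> V0" for z
  proof
    assume "openin Z {z}"
    then have "z \<in> G n" for n using dense_in_meets_openin[OF G(2)] by blast
    then show False using that V0(3) by blast
  qed
  obtain x0 where x0: "x0 \<in> wPS Z \<inter> V0"
    using dense_in_meets_openin[OF assms(3) V0(1,2)] by blast

  \<comment> \<open>the invariant of the tree nodes, each a point together with a neighbourhood of it\<close>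
  define ok where "ok p \<longleftrightarrow> fst p \<in> wPS Z \<inter> snd p \<and> openin Z (snd p) \<and> snd p \<subseteq> V0" for p
  define children where "children n p c \<longleftrightarrow>
      (\<forall>k::nat. ok (c k) \<and> Z closure_of snd (c k) \<subseteq> snd p \<inter> G n - {fst p}) \<and>
      (\<forall>k l. k \<noteq> l \<longrightarrow> snd (c k) \<inter> snd (c l) = {}) \<and>
      sets_converge_to Z (\<lambda>k. snd (c k)) (fst p)" for n p c
  have ex_children: "\<exists>c. children n p c" if "ok p" for n p
  proof -
    have "\<not> openin Z {z}" if "z \<in> snd p" for z
      using that no_isolated \<open>ok p\<close> unfolding ok_def by blast
    then obtain a W where aW:
      "\<And>k::nat. a k \<in> wPS Z \<inter> W k \<and> openin Z (W k) \<and> Z closure_of W k \<subseteq> snd p \<inter> G n - {fst p}"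
      "\<And>k l. k \<noteq> l \<Longrightarrow> W k \<inter> W l = {}" "sets_converge_to Z W (fst p)"
      using wPS_disjoint_open_sequence[OF assms(1-3), of "snd p" "G n" "fst p"] \<open>ok p\<close> G
      unfolding ok_def by (metis Int_iff)
    have "W k \<subseteq> V0" for k
      using aW(1)[of k] closure_of_subset[of "W k" Z] openin_subset[of Z "W k"] that
      unfolding ok_def by blast
    then show ?thesis using aW unfolding ok_def children_def
      by (intro exI[of _ "\<lambda>k. (a k, W k)"]) auto
  qed
  define c where "c n p = (SOME c. children n p c)" for n p
  have c: "children n p (c n p)" if "ok p" for n p
    unfolding c_def using ex_children[OF that] by (rule someI_ex)
  define T where "T = rec_list (x0, V0) (\<lambda>k s p. c (length s) p k)"
  have T_Cons: "T (k # s) = c (length s) (T s) k" for k s unfolding T_def by simp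
  have T_ok: "ok (T s)" for s
  proof (induction s)
    case Nil
    then show ?case using x0 V0 unfolding T_def ok_def by simp
  next
    case (Cons k s)
    then show ?case using c[of "T s" "length s"] by (simp add: T_Cons children_def)
  qed
  define x where "x s = fst (T s)" for s
  define V where "V s = snd (T s)" for s
  have xV: "x s \<in> V s" and V_open: "openin Z (V s)" and V_V0: "V s \<subseteq> V0" for s
    using T_ok[of s] unfolding ok_def x_def V_def by auto
  have xZ: "x s \<in> topspace Z" for s using xV V_open openin_subset by blast
  have V_closure: "Z closure_of V (k # s) \<subseteq> V s \<inter> G (length s) - {x s}"
    and V_disjoint: "k \<noteq> l \<Longrightarrow> V (k # s) \<inter> V (l # s) = {}"
    and V_converge: "sets_converge_to Z (\<lambda>k. V (k # s)) (x s)" for k l s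
    using c[OF T_ok[of s], of "length s"] unfolding children_def x_def V_def T_Cons by auto
  have V_Cons: "V (k # s) \<subseteq> V s - {x s}" for k s
    using V_closure[of k s] closure_of_subset[of "V (k # s)" Z] openin_subset[OF V_open] by blast
  have V_append: "V (t @ s) \<subseteq> V s" for t s
    by (induction t) (use V_Cons in auto)
  have V_level: "V s \<inter> V t = {}" if "length s = length t" "s \<noteq> t" for s t
    using that
  proof (induction s t rule: list_induct2)
    case (Cons k s l t)
    then show ?case using V_disjoint V_Cons by (cases "s = t") blast+
  qed simp
  \<comment> \<open>A point cannot recur at a deeper level: neighbourhoods of distinct nodes of one level are
    disjoint, and those of the descendants of a node avoid its point. So even and odd levels share
    no point.\<close>
  have x_level: "length s = length t" if "x s = x t" for s t
  proof -
    have False if eq: "x s = x t" and less: "length s < length t" for s t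
    proof -
      define m where "m = length t - Suc (length s)"
      obtain k u where ku: "drop m t = k # u" and len: "length u = length s"
        using less unfolding m_def
        by (metis Suc_diff_Suc Suc_leI diff_diff_cancel diff_le_self length_Suc_conv length_drop)
      have "x t \<in> V (k # u)"
        using xV[of t] V_append[of "take m t" "k # u"] ku append_take_drop_id[of m t] by auto
      then have "x s \<in> V u - {x u}" using V_Cons eq by auto
      then show False using V_level[OF len] xV[of s] by (cases "u = s") auto
    qed
    then show ?thesis using that by (metis linorder_neqE_nat)
  qed
  define D where "D s = range (\<lambda>t. x (t @ s))" for s
  have D_V: "D s \<subseteq> V s" for s unfolding D_def using xV V_append by blast
  have D_split: "D s = insert (x s) (\<Union>k. D (k # s))" for s
  proof
    show "D s \<subseteq> insert (x s) (\<Union>k. D (k # s))"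
    proof
      fix y assume "y \<in> D s"
      then obtain t where "y = x (t @ s)" unfolding D_def by blast
      then show "y \<in> insert (x s) (\<Union>k. D (k # s))"
        unfolding D_def by (cases t rule: rev_cases) auto
    qed
    have "x (t @ k # s) \<in> D s" for t k
      unfolding D_def by (rule range_eqI[of _ _ "t @ [k]"]) simp
    moreover have "x s \<in> D s"
      unfolding D_def by (rule range_eqI[of _ _ "[]"]) simp
    ultimately show "insert (x s) (\<Union>k. D (k # s)) \<subseteq> D s"
      unfolding D_def[of "_ # s"] by blast
  qed
  \<comment> \<open>Almost all children of \<open>s\<close> lie near \<open>x s\<close>, so a point of the closure other
    than \<open>x s\<close> is separated from them and is in the closure of the finite union of the
    remaining branches.\<close>
  have descend: "\<exists>k. y \<in> Z closure_of D (k # s)" if y: "y \<in> Z closure_of D s" "y \<noteq> x s" for y s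
  proof -
    have "y \<in> topspace Z" using y(1) by (simp add: in_closure_of)
    then obtain O1 O2 where O: "openin Z O1" "openin Z O2" "y \<in> O1" "x s \<in> O2" "O1 \<inter> O2 = {}"
      using Haus y(2) xZ[of s] unfolding Hausdorff_space_def disjnt_def by meson
    then obtain K where K: "\<And>k. k \<ge> K \<Longrightarrow> V (k # s) \<subseteq> O2"
      using V_converge[of s] unfolding sets_converge_to_def eventually_sequentially by blast
    have "D s \<subseteq> O2 \<union> (\<Union>k<K. D (k # s))"
    proof
      fix z assume "z \<in> D s"
      then consider "z = x s" | k where "z \<in> D (k # s)" using D_split by blast
      then show "z \<in> O2 \<union> (\<Union>k<K. D (k # s))"
      proof cases
        case (2 k)
        then show ?thesis using K[of k] D_V[of "k # s"] by (cases "k < K") auto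
      qed (use O in simp)
    qed
    then have "y \<in> Z closure_of (O2 \<union> (\<Union>k<K. D (k # s)))"
      using y(1) closure_of_mono by blast
    moreover have "y \<notin> Z closure_of O2" using O by (auto simp: in_closure_of)
    moreover have "Z closure_of (\<Union>k<K. D (k # s)) = (\<Union>k<K. Z closure_of D (k # s))"
      by (subst closure_of_Union) auto
    ultimately show ?thesis by auto
  qed
  have range_x: "range x = D []" unfolding D_def by simp
  have closed: "closedin Z (range x)"
  proof -
    have "y \<in> range x" if y: "y \<in> Z closure_of range x" for y
    proof (rule ccontr)
      assume "y \<notin> range x"
      have ex: "\<exists>s. length s = n \<and> y \<in> Z closure_of D s" for n
      proof (induction n)
        case 0
        then show ?case using y range_x by simp
      next
        case (Suc n)
        then obtain s where "length s = n" "y \<in> Z closure_of D s" by blast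
        moreover have "y \<noteq> x s" using \<open>y \<notin> range x\<close> by blast
        ultimately show ?case using descend by (metis length_Cons)
      qed
      have "y \<in> V0 \<inter> G n" for n
      proof -
        obtain s' where s': "length s' = Suc n" "y \<in> Z closure_of D s'" using ex by blast
        then obtain k s where s: "s' = k # s" "length s = n" by (auto simp: length_Suc_conv)
        have "y \<in> Z closure_of V (k # s)" using s' s closure_of_mono[OF D_V] by blast
        then show ?thesis using V_closure[of k s] V_V0[of s] s by blast
      qed
      then show False using V0(3) by blast
    qed
    then show ?thesis using xZ closure_of_subset_eq[of "range x" Z] by blast
  qed
  define A where "A = x ` {s. even (length s)}"
  define B where "B = x ` {s. odd (length s)}"
  have AB: "A \<union> B = range x" unfolding A_def B_def by auto
  have child: "\<exists>k. x (k # s) \<in> U" if U: "openin Z U" "x s \<in> U" for U s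
  proof -
    obtain K where "\<And>k. k \<ge> K \<Longrightarrow> V (k # s) \<subseteq> U"
      using V_converge[of s] U unfolding sets_converge_to_def eventually_sequentially by blast
    then show ?thesis using xV[of "K # s"] by blast
  qed
  have dense: "dense_in (subtopology Z (range x)) (x ` {s. P (length s)})"
    if P: "\<And>n. P n \<or> P (Suc n)" for P
    unfolding dense_in_iff_meets_openin
  proof (intro conjI allI impI)
    show "x ` {s. P (length s)} \<subseteq> topspace (subtopology Z (range x))" using xZ by auto
  next
    fix U assume "openin (subtopology Z (range x)) U \<and> U \<noteq> {}"
    then obtain U' s where U': "openin Z U'" "U = U' \<inter> range x" and s: "x s \<in> U'"
      unfolding openin_subtopology by blast
    obtain k where "x (k # s) \<in> U'" using child[OF U'(1) s] by blast
    then show "U \<inter> x ` {s. P (length s)} \<noteq> {}"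
      using s U'(2) P[of "length s"] by fastforce
  qed
  show thesis
  proof (rule that[of A B])
    show "closedin Z (A \<union> B)" using AB closed by simp
    show "countable (A \<union> B)" unfolding AB by simp
    show "A \<noteq> {}" unfolding A_def by (auto intro: exI[of _ "[]"])
    have "even (length s) \<longleftrightarrow> even (length t)" if "x s = x t" for s t
      using x_level[OF that] by simp
    then show "A \<inter> B = {}" unfolding A_def B_def by blast
    show "dense_in (subtopology Z (A \<union> B)) A"
      unfolding AB unfolding A_def by (rule dense) auto
    show "dense_in (subtopology Z (A \<union> B)) B"
      unfolding AB unfolding B_def by (rule dense) auto
  qed
qed

section \<open>Preservation of complete Baireness\<close>

theorem theorem3:
  fixes X :: "'a topology" and Y :: "'b topology" and f :: "'a \<Rightarrow> 'b"
  assumes "completely_Baire_space X"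
    and "regular_space Y" and "t1_space Y"
    and "hereditary_weakly_Preiss_Simon Y"
    and "continuous_map X Y f"
    and "f ` topspace X = topspace Y"
    and "\<And>U. openin X U \<Longrightarrow> resolvable_in Y (f ` U)"
  shows "completely_Baire_space Y"
  unfolding completely_Baire_space_def
proof (intro allI impI, rule ccontr)
  fix F assume F: "closedin Y F" and not_Baire: "\<not> Baire_space (subtopology Y F)"
  let ?Z = "subtopology Y F"
  have "topspace ?Z = F" using F closedin_subset by fastforce
  have "F \<noteq> {}"
  proof
    assume "F = {}"
    then have "Baire_space ?Z" unfolding Baire_space_def dense_in_def by auto
    then show False using not_Baire by simp
  qed
  then have "dense_in ?Z (wPS ?Z)"
    using assms(4) F unfolding hereditary_weakly_Preiss_Simon_def by blast
  then obtain A B where AB: "closedin ?Z (A \<union> B)" "countable (A \<union> B)" "A \<noteq> {}" "A \<inter> B = {}"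
    "dense_in (subtopology ?Z (A \<union> B)) A" "dense_in (subtopology ?Z (A \<union> B)) B"
    using non_Baire_closed_countable_two_dense[OF regular_space_subtopology[OF assms(2)]
        t1_space_subtopology[OF assms(3)] _ not_Baire] by metis
  define D where "D = A \<union> B"
  have D: "closedin Y D" using AB(1) F closedin_trans_full unfolding D_def by blast
  have "D \<subseteq> F" using AB(1) closedin_subset[of ?Z] \<open>topspace ?Z = F\<close> unfolding D_def by blast
  then have sub: "subtopology ?Z D = subtopology Y D"
    by (simp add: subtopology_subtopology Int_absorb1)
  have top: "topspace (subtopology Y D) = D" using D closedin_subset by fastforce
  define C where "C = {x \<in> topspace X. f x \<in> D}"
  have C: "closedin X C" unfolding C_def using assms(5) D closedin_continuous_map_preimage by blast
  have "topspace (subtopology Y D) = {}"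
  proof (rule resolvable_images_countable_no_disjoint_dense)
    show "Baire_space (subtopology X C)"
      using assms(1) C unfolding completely_Baire_space_def by blast
    show "continuous_map (subtopology X C) (subtopology Y D) f"
      using assms(5) unfolding C_def
      by (auto simp: continuous_map_in_subtopology continuous_map_from_subtopology)
    have "f ` C = D"
      using assms(6) closedin_subset[OF D] unfolding C_def by auto
    then show "f ` topspace (subtopology X C) = topspace (subtopology Y D)"
      using top closedin_subset[OF C] by (simp add: Int_absorb1)
    show "t1_space (subtopology Y D)" using assms(3) by (rule t1_space_subtopology)
    show "countable (topspace (subtopology Y D))" using AB(2) top D_def by simp
    show "dense_in (subtopology Y D) A" "dense_in (subtopology Y D) B"
      using AB(5,6) sub unfolding D_def by simp_all
    show "A \<inter> B = {}" by fact
  next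
    fix U assume "openin (subtopology X C) U"
    then obtain U' where U': "openin X U'" "U = U' \<inter> C" unfolding openin_subtopology by blast
    have "f ` U = f ` U' \<inter> D"
      using U' openin_subset[OF U'(1)] unfolding C_def by blast
    then show "resolvable_in (subtopology Y D) (f ` U)"
      using resolvable_in_subtopology[OF assms(7)[OF U'(1)]] by simp
  qed
  then show False using AB(3) top unfolding D_def by blast
qed

end
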